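(* A connected graph $G$ has $\operatorname{th}_{\rm pd}^{\times}(G)=2$ if and only if $G$ satisfies one or both of the following conditions: (a) $\gamma(G)=2$; (b) $\gamma_P(G)=1$ and $\operatorname{pt}_{\rm pd}(G)=2$.
   Context: All graphs are finite, simple and undirected with at least one vertex. Let $G$ be a graph. $\gamma(G)$ is the domination number: the minimum $|S|$ over $S\subseteq V(G)$ with $N[S]=V(G)$, where $N[S]$ is the closed neighborhood of $S$. For nonempty $S\subseteq V(G)$ define $P^{[0]}(S)=S$, $P^{[1]}(S)=N[S]$, and for $i\ge 1$, $P^{[i+1]}(S)=P^{[i]}(S)\cup\{w\in V(G)\setminus P^{[i]}(S): \exists u\in P^{[i]}(S),\ N(u)\setminus P^{[i]}(S)=\{w\}\}$. $S$ is a power dominating set if $P^{[t]}(S)=V(G)$ for some $t$; the power domination number $\gamma_P(G)$ is the minimum cardinality of a power dominating set. The power propagation time of $S$, $\operatorname{pt}_{\rm pd}(G;S)$, is the least positive integer $t$ with $P^{[t]}(S)=V(G)$ (so it is at least $1$, even for $S=V(G)$), and is $\infty$ if $S$ is not a power dominating set. The power propagation time of $G$ is $\operatorname{pt}_{\rm pd}(G)=\min\{\operatorname{pt}_{\rm pd}(G;S): |S|=\gamma_P(G)\}$. The product power throttling number is $\operatorname{th}_{\rm pd}^{\times}(G)=\min_{\emptyset\ne S\subseteq V(G)}|S|\operatorname{pt}_{\rm pd}(G;S)$. *)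

theory Defs
  imports "Graph_Theory.Digraph_Component" "HOL-Library.Extended_Nat"
begin

text \<open>
  A finite simple undirected graph is a \<^const>\<open>graph\<close> in the sense of Graph\_Theory: a finite,
  loop-free, symmetric digraph without parallel arcs, an edge \<open>{u, v}\<close> being the pair of
  arcs \<open>(u, v)\<close> and \<open>(v, u)\<close>. Graph\_Theory admits the null graph, but its predicate
  \<^term>\<open>Digraph_Component.connected\<close> requires a nonempty vertex set.
\<close>

definition open_nbhd :: "('a, 'b) pre_digraph \<Rightarrow> 'a \<Rightarrow> 'a set" where
  "open_nbhd G u = {v. u \<rightarrow>\<^bsub>G\<^esub> v}"

definition closed_nbhd :: "('a, 'b) pre_digraph \<Rightarrow> 'a set \<Rightarrow> 'a set" where
  "closed_nbhd G S = S \<union> (\<Union>u\<in>S. open_nbhd G u)"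

definition dominating_set :: "('a, 'b) pre_digraph \<Rightarrow> 'a set \<Rightarrow> bool" where
  "dominating_set G S \<longleftrightarrow> S \<subseteq> verts G \<and> closed_nbhd G S = verts G"

definition domination_number :: "('a, 'b) pre_digraph \<Rightarrow> nat" where
  "domination_number G = Min (card ` {S. dominating_set G S})"

fun power_prop :: "('a, 'b) pre_digraph \<Rightarrow> 'a set \<Rightarrow> nat \<Rightarrow> 'a set" where
  "power_prop G S 0 = S"
| "power_prop G S (Suc 0) = closed_nbhd G S"
| "power_prop G S (Suc (Suc i)) =
     power_prop G S (Suc i) \<union>
     {w \<in> verts G - power_prop G S (Suc i).
        \<exists>u \<in> power_prop G S (Suc i). open_nbhd G u - power_prop G S (Suc i) = {w}}"

definition power_dominating_set :: "('a, 'b) pre_digraph \<Rightarrow> 'a set \<Rightarrow> bool" where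
  "power_dominating_set G S \<longleftrightarrow>
     S \<subseteq> verts G \<and> S \<noteq> {} \<and> (\<exists>t. power_prop G S t = verts G)"

definition power_domination_number :: "('a, 'b) pre_digraph \<Rightarrow> nat" where
  "power_domination_number G = Min (card ` {S. power_dominating_set G S})"

text \<open>
  The least time is taken over positive \<open>t\<close> only, so it is \<open>1\<close> for \<open>S = verts G\<close>. Such
  a \<open>t\<close> exists for every power dominating set, since \<^term>\<open>power_prop G S\<close> stays
  at \<^term>\<open>verts G\<close> once it has reached it.
\<close>
definition power_prop_time_of :: "('a, 'b) pre_digraph \<Rightarrow> 'a set \<Rightarrow> enat" where
  "power_prop_time_of G S =
     (if power_dominating_set G S then enat (LEAST t. 0 < t \<and> power_prop G S t = verts G)
      else \<infinity>)"

definition power_prop_time :: "('a, 'b) pre_digraph \<Rightarrow> enat" where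
  "power_prop_time G =
     Min (power_prop_time_of G ` {S. S \<subseteq> verts G \<and> card S = power_domination_number G})"

definition product_power_throttling :: "('a, 'b) pre_digraph \<Rightarrow> enat" where
  "product_power_throttling G =
     Min ((\<lambda>S. enat (card S) * power_prop_time_of G S) ` {S. S \<subseteq> verts G \<and> S \<noteq> {}})"

end

theory Submission
  imports Defs
begin

text \<open>
  The only ways to write 2 as a product of positive integers are \<open>2 * 1\<close> and \<open>1 * 2\<close>. Propagation
  time 1 means domination, so a set attaining the throttling number 2 is either a dominating pair
  or a single vertex of propagation time 2; the value 1 is attained exactly when some single vertex
  dominates.
\<close>

text \<open>Every graph parameter here is a \<open>Min\<close> over an image. This splits an
  equation for such a minimum into attainment and a lower bound.\<close>

lemma Min_image_eq_iff:
  fixes f :: "'a \<Rightarrow> 'b :: linorder"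
  assumes "finite A" and "A \<noteq> {}"
  shows "Min (f ` A) = m \<longleftrightarrow> (\<exists>x\<in>A. f x = m) \<and> (\<forall>x\<in>A. m \<le> f x)"
  using assms by (subst Min_eq_iff) auto

lemma enat_mult_eq_2_iff:
  "enat a * x = 2 \<longleftrightarrow> a = 1 \<and> x = 2 \<or> a = 2 \<and> x = 1"
proof (cases x)
  case (enat n)
  have "a * n = 2 \<longleftrightarrow> a = 1 \<and> n = 2 \<or> a = 2 \<and> n = 1"
  proof
    assume *: "a * n = 2"
    then have "a dvd 2" by (metis dvd_triv_left)
    then have "a \<le> 2" by (simp add: dvd_imp_le)
    then have "a = 0 \<or> a = 1 \<or> a = 2" by auto
    with * show "a = 1 \<and> n = 2 \<or> a = 2 \<and> n = 1" by auto
  qed auto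
  with enat show ?thesis by (simp add: numeral_eq_enat one_enat_def)
next
  \<comment> \<open>The product is \<infinity>, or 0 when \<open>a = 0\<close>, so it is never
    2.\<close>
  case infinity
  then show ?thesis by simp
qed

context wf_digraph
begin

lemma closed_nbhd_verts: "closed_nbhd G (verts G) = verts G"
  by (auto simp: closed_nbhd_def open_nbhd_def)

lemma dominating_set_verts: "dominating_set G (verts G)"
  by (simp add: dominating_set_def closed_nbhd_verts)

text \<open>A power dominating set may be witnessed by time 0, which the least time excludes. That
  witness forces \<open>S = verts G\<close>, and then time 1 works as well, since
  \<open>verts G\<close> is its own closed neighborhood.\<close>

lemma power_dominating_set_time:
  assumes "power_dominating_set G S"
  obtains t where "0 < t" and "power_prop G S t = verts G"
proof -
  from assms obtain t where t: "power_prop G S t = verts G"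
    by (auto simp: power_dominating_set_def)
  show thesis
  proof (cases "t = 0")
    case True
    with t have "power_prop G S 1 = verts G" by (simp add: closed_nbhd_verts)
    then show thesis using that[of 1] by simp
  next
    case False
    with t show thesis using that by blast
  qed
qed

lemma power_prop_time_of_ge_1: "1 \<le> power_prop_time_of G S"
proof (cases "power_dominating_set G S")
  case True
  then obtain t where "0 < t \<and> power_prop G S t = verts G"
    using power_dominating_set_time by blast
  \<comment> \<open>\<open>LEAST\<close> is positive only because a positive witness exists.\<close>
  then have "0 < (LEAST t. 0 < t \<and> power_prop G S t = verts G)"
    by (metis (mono_tags, lifting) LeastI)
  with True show ?thesis by (simp add: power_prop_time_of_def one_enat_def)
qed (simp add: power_prop_time_of_def)

lemma dominating_set_imp_power_dominating_set:
  assumes "dominating_set G S" and "S \<noteq> {}"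
  shows "power_dominating_set G S"
  using assms power_prop.simps(2)[of G S]
  unfolding dominating_set_def power_dominating_set_def by blast

lemma power_prop_time_of_eq_1_iff:
  assumes "S \<subseteq> verts G" and "S \<noteq> {}"
  shows "power_prop_time_of G S = 1 \<longleftrightarrow> dominating_set G S"
proof
  assume L: "power_prop_time_of G S = 1"
  then have S: "power_dominating_set G S"
    by (auto simp: power_prop_time_of_def split: if_splits)
  with L have least: "(LEAST t. 0 < t \<and> power_prop G S t = verts G) = 1"
    by (simp add: power_prop_time_of_def one_enat_def)
  obtain t where "0 < t \<and> power_prop G S t = verts G"
    using power_dominating_set_time[OF S] by blast
  from LeastI[of "\<lambda>t. 0 < t \<and> power_prop G S t = verts G", OF this]
  show "dominating_set G S" using least assms by (simp add: dominating_set_def)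
next
  assume R: "dominating_set G S"
  then have "(LEAST t. 0 < t \<and> power_prop G S t = verts G) = 1"
    by (intro Least_equality) (auto simp: dominating_set_def)
  with dominating_set_imp_power_dominating_set[OF R assms(2)]
  show "power_prop_time_of G S = 1" by (simp add: power_prop_time_of_def one_enat_def)
qed

end

context fin_digraph
begin

lemma domination_number_eq_iff:
  "domination_number G = k \<longleftrightarrow>
    (\<exists>S. dominating_set G S \<and> card S = k) \<and> (\<forall>S. dominating_set G S \<longrightarrow> k \<le> card S)"
proof -
  have "finite {S. dominating_set G S}"
    by (rule finite_subset[of _ "Pow (verts G)"]) (auto simp: dominating_set_def)
  moreover have "{S. dominating_set G S} \<noteq> {}"
    using dominating_set_verts by blast
  ultimately show ?thesis
    unfolding domination_number_def by (subst Min_image_eq_iff) auto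
qed

lemma power_domination_number_eq_iff:
  assumes "verts G \<noteq> {}"
  shows "power_domination_number G = k \<longleftrightarrow>
    (\<exists>S. power_dominating_set G S \<and> card S = k) \<and>
    (\<forall>S. power_dominating_set G S \<longrightarrow> k \<le> card S)"
proof -
  have "finite {S. power_dominating_set G S}"
    by (rule finite_subset[of _ "Pow (verts G)"]) (auto simp: power_dominating_set_def)
  moreover have "{S. power_dominating_set G S} \<noteq> {}"
    using dominating_set_imp_power_dominating_set[OF dominating_set_verts assms] by blast
  ultimately show ?thesis
    unfolding power_domination_number_def by (subst Min_image_eq_iff) auto
qed

text \<open>The sets of minimum size that are not power dominating have time \<infinity>, so ranging
  over them too does not lower the minimum.\<close>

lemma power_prop_time_eq_iff:
  assumes "verts G \<noteq> {}"
  shows "power_prop_time G = t \<longleftrightarrow>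
    (\<exists>S\<subseteq>verts G. card S = power_domination_number G \<and> power_prop_time_of G S = t) \<and>
    (\<forall>S\<subseteq>verts G. card S = power_domination_number G \<longrightarrow> t \<le> power_prop_time_of G S)"
proof -
  let ?A = "{S. S \<subseteq> verts G \<and> card S = power_domination_number G}"
  have "finite ?A" by (rule finite_subset[of _ "Pow (verts G)"]) auto
  moreover have "?A \<noteq> {}"
    \<comment> \<open>Taking \<open>k\<close> to be the power domination number itself makes the
      left side trivial and yields a power dominating set that attains it.\<close>
    using power_domination_number_eq_iff[OF assms, of "power_domination_number G"]
    by (auto simp: power_dominating_set_def)
  ultimately show ?thesis
    unfolding power_prop_time_def by (subst Min_image_eq_iff) auto
qed

lemma product_power_throttling_eq_iff:
  assumes "verts G \<noteq> {}"
  shows "product_power_throttling G = k \<longleftrightarrow>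
    (\<exists>S\<subseteq>verts G. S \<noteq> {} \<and> enat (card S) * power_prop_time_of G S = k) \<and>
    (\<forall>S\<subseteq>verts G. S \<noteq> {} \<longrightarrow> k \<le> enat (card S) * power_prop_time_of G S)"
proof -
  let ?A = "{S. S \<subseteq> verts G \<and> S \<noteq> {}}"
  have "finite ?A" by (rule finite_subset[of _ "Pow (verts G)"]) auto
  moreover have "?A \<noteq> {}" using assms by auto
  ultimately show ?thesis
    unfolding product_power_throttling_def by (subst Min_image_eq_iff) auto
qed

text \<open>Both factors are at least 1, so the product falls below 2 only if both equal 1, and time
  1 means domination.\<close>

lemma card_mult_power_prop_time_of_ge_2_iff:
  assumes "S \<subseteq> verts G" and "S \<noteq> {}"
  shows "2 \<le> enat (card S) * power_prop_time_of G S \<longleftrightarrow> \<not> (card S = 1 \<and> dominating_set G S)"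
proof -
  have c: "0 < card S"
    using assms finite_subset[OF assms(1) finite_verts] by (simp add: card_gt_0_iff)
  show ?thesis
  proof (cases "power_prop_time_of G S")
    case (enat n)
    with power_prop_time_of_ge_1[of S] have n: "1 \<le> n" by (simp add: one_enat_def)
    with c have "1 \<le> card S * n" by simp
    then have "2 \<le> card S * n \<longleftrightarrow> \<not> card S * n = 1" by linarith
    with enat show ?thesis
      by (simp add: power_prop_time_of_eq_1_iff[OF assms, symmetric] numeral_eq_enat one_enat_def)
  next
    case infinity
    with c show ?thesis
      by (simp add: power_prop_time_of_eq_1_iff[OF assms, symmetric] imult_is_infinity zero_enat_def)
  qed
qed

theorem product_power_throttling_eq_2_iff:
  assumes ne: "verts G \<noteq> {}"
  shows "product_power_throttling G = 2 \<longleftrightarrow>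
    domination_number G = 2 \<or> (power_domination_number G = 1 \<and> power_prop_time G = 2)"
proof -
  \<comment> \<open>Each condition in the claim becomes a Boolean combination of these three
    statements, which leaves a propositional equivalence.\<close>
  let ?D1 = "\<exists>S. dominating_set G S \<and> card S = 1"
  let ?D2 = "\<exists>S. dominating_set G S \<and> card S = 2"
  let ?T2 = "\<exists>S\<subseteq>verts G. card S = 1 \<and> power_prop_time_of G S = 2"
  have D_iff: "dominating_set G S \<longleftrightarrow> S \<subseteq> verts G \<and> power_prop_time_of G S = 1" if "0 < card S" for S
  proof -
    from that have "S \<noteq> {}" by auto
    then show ?thesis using power_prop_time_of_eq_1_iff[of S] by (auto simp: dominating_set_def)
  qed
  have pos: "0 < card S" if "S \<subseteq> verts G" "S \<noteq> {}" for S
    using that finite_subset[OF _ finite_verts] by (auto simp: card_gt_0_iff)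

  have dom: "domination_number G = 2 \<longleftrightarrow> ?D2 \<and> \<not> ?D1"
  proof -
    \<comment> \<open>The empty set has empty closed neighborhood, so it cannot dominate a nonempty
      graph.\<close>
    have "0 < card S" if "dominating_set G S" for S
      using that ne pos[of S] by (cases "S = {}") (auto simp: dominating_set_def closed_nbhd_def)
    then have "2 \<le> card S \<longleftrightarrow> card S \<noteq> 1" if "dominating_set G S" for S
      using that by (metis One_nat_def Suc_leI le_neq_implies_less numeral_2_eq_2 not_less_eq_eq order_refl)
    then show ?thesis by (auto simp: domination_number_eq_iff)
  qed

  have throttle: "product_power_throttling G = 2 \<longleftrightarrow> (?D2 \<or> ?T2) \<and> \<not> ?D1"
  proof -
    have "(\<exists>S\<subseteq>verts G. S \<noteq> {} \<and> enat (card S) * power_prop_time_of G S = 2) \<longleftrightarrow> ?D2 \<or> ?T2"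
    proof -
      have "S \<subseteq> verts G \<and> S \<noteq> {} \<and> enat (card S) * power_prop_time_of G S = 2 \<longleftrightarrow>
          dominating_set G S \<and> card S = 2 \<or>
          S \<subseteq> verts G \<and> card S = 1 \<and> power_prop_time_of G S = 2" for S
        unfolding enat_mult_eq_2_iff using D_iff[of S] by auto
      then show ?thesis by blast
    qed
    moreover have "(\<forall>S\<subseteq>verts G. S \<noteq> {} \<longrightarrow> 2 \<le> enat (card S) * power_prop_time_of G S) \<longleftrightarrow> \<not> ?D1"
    proof -
      have "(S \<subseteq> verts G \<longrightarrow> S \<noteq> {} \<longrightarrow> 2 \<le> enat (card S) * power_prop_time_of G S) \<longleftrightarrow>
          \<not> (dominating_set G S \<and> card S = 1)" for S
        using card_mult_power_prop_time_of_ge_2_iff[of S] by (auto simp: dominating_set_def)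
      then show ?thesis by simp
    qed
    ultimately show ?thesis by (simp only: product_power_throttling_eq_iff[OF ne])
  qed

  have power: "power_domination_number G = 1 \<and> power_prop_time G = 2 \<longleftrightarrow> ?T2 \<and> \<not> ?D1"
  proof -
    \<comment> \<open>A finite time certifies that the singleton is power dominating, and no power
      dominating set is smaller because all are nonempty.\<close>
    have "?T2 \<longrightarrow> power_domination_number G = 1"
    proof
      assume ?T2
      then have "\<exists>S. power_dominating_set G S \<and> card S = 1"
        by (auto simp: power_prop_time_of_def split: if_splits)
      moreover have "1 \<le> card S" if "power_dominating_set G S" for S
        using that pos[of S] by (auto simp: power_dominating_set_def)
      ultimately show "power_domination_number G = 1"
        by (simp add: power_domination_number_eq_iff[OF ne])
    qed
    moreover have "(S \<subseteq> verts G \<longrightarrow> card S = 1 \<longrightarrow> 2 \<le> power_prop_time_of G S) \<longleftrightarrow>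
        \<not> (dominating_set G S \<and> card S = 1)" for S
    proof (cases "S \<subseteq> verts G \<and> card S = 1")
      case True
      then have "S \<noteq> {}" by auto
      \<comment> \<open>For a singleton the product is the propagation time itself.\<close>
      with True show ?thesis
        using card_mult_power_prop_time_of_ge_2_iff[of S] by (simp add: enat_1 del: One_nat_def)
    qed (auto simp: dominating_set_def)
    then have "(\<forall>S\<subseteq>verts G. card S = 1 \<longrightarrow> 2 \<le> power_prop_time_of G S) \<longleftrightarrow> \<not> ?D1"
      by simp
    ultimately show ?thesis
      \<comment> \<open>If the number is 1, the sets over which \<open>power_prop_time\<close>
        minimizes are the singletons. Otherwise \<open>?T2\<close> fails by the first fact and both
        sides are false.\<close>
      by (cases "power_domination_number G = 1") (simp add: power_prop_time_eq_iff[OF ne], blast)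
  qed
  show ?thesis unfolding throttle dom power by blast
qed

end

theorem theorem4p1:
  fixes G :: "('a, 'b) pre_digraph"
  assumes "graph G" and "Digraph_Component.connected G"
  shows "product_power_throttling G = 2 \<longleftrightarrow>
    domination_number G = 2 \<or> (power_domination_number G = 1 \<and> power_prop_time G = 2)"
proof -
  interpret graph G by fact
  from assms(2) have "verts G \<noteq> {}"
    by (auto simp: connected_def strongly_connected_def)
  then show ?thesis by (rule product_power_throttling_eq_2_iff)
qed

end
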